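(* The functor $\mathcal{P}_1\colon\mathbf{Cat_1}\to\mathbf{Cat_1}$ together with the natural transformations $\eta\colon\mathrm{id}_{\mathbf{Cat_1}}\to\mathcal{P}_1$ and $\mu\colon\mathcal{P}_1^2\to\mathcal{P}_1$ form a monad.
   Context: **Categorders and functorders.** An ordering is a partial order. A categorder is a category $\mathscr{C}$ with an ordering on each hom set such that for $c_1,c_2\colon C\to C'$ and $c_1',c_2'\colon C'\to C''$, $c_1\le c_2$ and $c_1'\le c_2'$ imply $c_1'\circ c_1\le c_2'\circ c_2$. A functorder $F\colon\mathscr{C}\to\mathscr{D}$ between categorders consists of a function $F\colon\mathrm{ob}\,\mathscr{C}\to\mathrm{ob}\,\mathscr{D}$ and functions $F\colon\mathscr{C}(C,C')\to\mathscr{D}(FC,FC')$ that are monotone ($c\le c'$ implies $Fc\le Fc'$) and satisfy $F(\mathrm{id}_C)\le\mathrm{id}_{FC}$ and $F(c'\circ c)\le Fc'\circ Fc$. $\mathbf{Cat_1}$ is the category of small categorders and functorders, with the evident identities and composition. **Power categorder.** For a small categorder $\mathscr{C}$, order $\mathrm{mor}\,\mathscr{C}$ by the orderings of the hom sets (morphisms in different hom sets are incomparable), and write ${\downarrow}A$ for the down closure of $A\subseteq\mathrm{mor}\,\mathscr{C}$. The categorder $\mathcal{P}_1\mathscr{C}$ has as objects all subsets $\mathcal{C}\subseteq\mathrm{ob}\,\mathscr{C}$; its morphisms $\mathcal{C}\to\mathcal{C}'$ are the down closed subsets of $\mathscr{C}(\mathcal{C},\mathcal{C}')=\bigcup_{C\in\mathcal{C},C'\in\mathcal{C}'}\mathscr{C}(C,C')$,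 ordered by inclusion (the same set of morphisms occurring in different hom sets is regarded as giving different morphisms); $\mathrm{id}_{\mathcal{C}}={\downarrow}\{\mathrm{id}_C\mid C\in\mathcal{C}\}$; and $\mathbf{c}'\circ\mathbf{c}={\downarrow}\{c'\circ c\mid c\in\mathbf{c},\,c'\in\mathbf{c}',\ c'\circ c\text{ defined}\}$. For a functorder $F\colon\mathscr{C}\to\mathscr{D}$, the functorder $\mathcal{P}_1F=F_{\to}\colon\mathcal{P}_1\mathscr{C}\to\mathcal{P}_1\mathscr{D}$ is given by $F_{\to}(\mathcal{C})=\{FC\mid C\in\mathcal{C}\}$ and $F_{\to}(\mathbf{c})={\downarrow}\{Fc\mid c\in\mathbf{c}\}$. **Unit and multiplication.** $\eta_{\mathscr{C}}\colon\mathscr{C}\to\mathcal{P}_1\mathscr{C}$ is $C\mapsto\{C\}$ on objects and $c\mapsto{\downarrow}\{c\}$ on morphisms. $\mu_{\mathscr{C}}\colon\mathcal{P}_1^2\mathscr{C}\to\mathcal{P}_1\mathscr{C}$ is given by unions: an object $\mathbb{C}$ (a set of subsets of $\mathrm{ob}\,\mathscr{C}$) is sent to $\bigcup\mathbb{C}$, and a morphism $\mathbb{C}\to\mathbb{C}'$, which is a down closed collection of morphisms $\mathbf{c}\colon\mathcal{C}\to\mathcal{C}'$ of $\mathcal{P}_1\mathscr{C}$ with $\mathcal{C}\in\mathbb{C}$, $\mathcal{C}'\in\mathbb{C}'$, is sent to the union of the sets $\mathbf{c}$ in it, viewed as a morphism $\bigcup\mathbb{C}\to\bigcup\mathbb{C}'$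 of $\mathcal{P}_1\mathscr{C}$. *)

theory Defs
  imports "HOL-Library.FuncSet"
begin

text \<open>
  A categorder is given by carrier sets of objects and morphisms, so its hom sets are disjoint.
  The relation \<open>leq C\<close> is the ordering of the set of all morphisms that the orderings of the hom
  sets induce; morphisms in different hom sets are incomparable. Smallness is expressed by the
  carriers being sets over HOL types. The operations are only specified on the carriers.
\<close>

record ('o, 'm) categorder =
  obj :: "'o set"
  mor :: "'m set"
  src :: "'m \<Rightarrow> 'o"
  tgt :: "'m \<Rightarrow> 'o"
  ident :: "'o \<Rightarrow> 'm"
  cmp :: "'m \<Rightarrow> 'm \<Rightarrow> 'm"  \<comment> \<open>\<open>cmp C g f\<close> is \<open>g\<close> after \<open>f\<close>\<close>
  leq :: "'m \<Rightarrow> 'm \<Rightarrow> bool"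

definition hom :: "('o, 'm) categorder \<Rightarrow> 'o \<Rightarrow> 'o \<Rightarrow> 'm set" where
  "hom C x y = {f \<in> mor C. src C f = x \<and> tgt C f = y}"

locale categorder =
  fixes C :: "('o, 'm) categorder"
  assumes src_obj: "f \<in> mor C \<Longrightarrow> src C f \<in> obj C"
    and tgt_obj: "f \<in> mor C \<Longrightarrow> tgt C f \<in> obj C"
    and ident_hom: "x \<in> obj C \<Longrightarrow> ident C x \<in> hom C x x"
    and cmp_hom: "f \<in> hom C x y \<Longrightarrow> g \<in> hom C y z \<Longrightarrow> cmp C g f \<in> hom C x z"
    and cmp_ident_right: "f \<in> hom C x y \<Longrightarrow> cmp C f (ident C x) = f"
    and cmp_ident_left: "f \<in> hom C x y \<Longrightarrow> cmp C (ident C y) f = f"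
    and cmp_assoc: "f \<in> hom C w x \<Longrightarrow> g \<in> hom C x y \<Longrightarrow> h \<in> hom C y z \<Longrightarrow>
      cmp C h (cmp C g f) = cmp C (cmp C h g) f"
    and leq_parallel: "f \<in> mor C \<Longrightarrow> g \<in> mor C \<Longrightarrow> leq C f g \<Longrightarrow>
      src C f = src C g \<and> tgt C f = tgt C g"
    and leq_refl: "f \<in> mor C \<Longrightarrow> leq C f f"
    and leq_trans: "f \<in> mor C \<Longrightarrow> g \<in> mor C \<Longrightarrow> h \<in> mor C \<Longrightarrow>
      leq C f g \<Longrightarrow> leq C g h \<Longrightarrow> leq C f h"
    and leq_antisym: "f \<in> mor C \<Longrightarrow> g \<in> mor C \<Longrightarrow> leq C f g \<Longrightarrow> leq C g f \<Longrightarrow> f = g"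
    and cmp_mono: "f1 \<in> hom C x y \<Longrightarrow> f2 \<in> hom C x y \<Longrightarrow> g1 \<in> hom C y z \<Longrightarrow> g2 \<in> hom C y z \<Longrightarrow>
      leq C f1 f2 \<Longrightarrow> leq C g1 g2 \<Longrightarrow> leq C (cmp C g1 f1) (cmp C g2 f2)"

text \<open>
  The two functions of a functorder are extensional (\<open>undefined\<close> outside the carriers of the
  domain), so that HOL equality of functorders with the same domain and codomain is equality
  of morphisms in the category of categorders.
\<close>

record ('o, 'm, 'p, 'n) functorder =
  fobj :: "'o \<Rightarrow> 'p"
  fmor :: "'m \<Rightarrow> 'n"

locale functorder = dom: categorder C + cod: categorder D
  for C :: "('o, 'm) categorder" and D :: "('p, 'n) categorder" +
  fixes F :: "('o, 'm, 'p, 'n) functorder"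
  assumes fobj_obj: "fobj F \<in> obj C \<rightarrow>\<^sub>E obj D"
    and fmor_ext: "fmor F \<in> extensional (mor C)"
    and fmor_hom: "f \<in> hom C x y \<Longrightarrow> fmor F f \<in> hom D (fobj F x) (fobj F y)"
    and fmor_mono: "f \<in> hom C x y \<Longrightarrow> g \<in> hom C x y \<Longrightarrow> leq C f g \<Longrightarrow> leq D (fmor F f) (fmor F g)"
    and fmor_ident: "x \<in> obj C \<Longrightarrow> leq D (fmor F (ident C x)) (ident D (fobj F x))"
    and fmor_cmp: "f \<in> hom C x y \<Longrightarrow> g \<in> hom C y z \<Longrightarrow>
      leq D (fmor F (cmp C g f)) (cmp D (fmor F g) (fmor F f))"

definition idF :: "('o, 'm) categorder \<Rightarrow> ('o, 'm, 'o, 'm) functorder" where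
  "idF C = \<lparr>fobj = (\<lambda>x\<in>obj C. x), fmor = (\<lambda>f\<in>mor C. f)\<rparr>"

text \<open>\<open>compF C G F\<close> is \<open>G\<close> after \<open>F\<close>, where \<open>C\<close> is the domain of \<open>F\<close>.\<close>

definition compF :: "('o, 'm) categorder \<Rightarrow> ('p, 'n, 'q, 'l) functorder \<Rightarrow>
    ('o, 'm, 'p, 'n) functorder \<Rightarrow> ('o, 'm, 'q, 'l) functorder" where
  "compF C G F = \<lparr>fobj = (\<lambda>x\<in>obj C. fobj G (fobj F x)), fmor = (\<lambda>f\<in>mor C. fmor G (fmor F f))\<rparr>"

lemma functorder_idF:
  assumes "categorder C"
  shows "functorder C C (idF C)"
proof -
  interpret categorder C by fact
  show ?thesis
    by unfold_locales
      (use ident_hom cmp_hom src_obj tgt_obj leq_refl in \<open>auto simp: idF_def hom_def\<close>)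
qed

lemma functorder_compF:
  assumes "functorder C D F" "functorder D E G"
  shows "functorder C E (compF C G F)"
proof -
  interpret F: functorder C D F by fact
  interpret G: functorder D E G by fact
  have mor_of_hom: "f \<in> mor C" if "f \<in> hom C x y" for f x y
    using that by (simp add: hom_def)
  have obj_of_hom: "x \<in> obj C \<and> y \<in> obj C" if "f \<in> hom C x y" for f x y
    using that F.dom.src_obj F.dom.tgt_obj by (auto simp: hom_def)
  have trans: "leq E a c" if "leq E a b" "leq E b c" "a \<in> hom E u v" "b \<in> hom E u v" "c \<in> hom E u v"
    for a b c u v
    using that G.cod.leq_trans[of a b c] by (simp add: hom_def)
  show ?thesis
  proof
    show "fobj (compF C G F) \<in> obj C \<rightarrow>\<^sub>E obj E"
      using F.fobj_obj G.fobj_obj by (auto simp: compF_def)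
    show "fmor (compF C G F) \<in> extensional (mor C)"
      by (simp add: compF_def)
    show "fmor (compF C G F) f \<in> hom E (fobj (compF C G F) x) (fobj (compF C G F) y)"
      if "f \<in> hom C x y" for f x y
      using that mor_of_hom[OF that] obj_of_hom[OF that] G.fmor_hom[OF F.fmor_hom[OF that]]
      by (simp add: compF_def)
    show "leq E (fmor (compF C G F) f) (fmor (compF C G F) g)"
      if "f \<in> hom C x y" "g \<in> hom C x y" "leq C f g" for f g x y
      using that mor_of_hom G.fmor_mono[OF F.fmor_hom F.fmor_hom F.fmor_mono]
      by (auto simp: compF_def)
    show "leq E (fmor (compF C G F) (ident C x)) (ident E (fobj (compF C G F) x))"
      if "x \<in> obj C" for x
    proof -
      have i: "ident C x \<in> hom C x x" and Fx: "fobj F x \<in> obj D"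
        and GFx: "fobj G (fobj F x) \<in> obj E"
        using that F.dom.ident_hom F.fobj_obj G.fobj_obj by auto
      have "leq E (fmor G (fmor F (ident C x))) (ident E (fobj G (fobj F x)))"
        by (rule trans[OF G.fmor_mono[OF F.fmor_hom[OF i] F.cod.ident_hom[OF Fx] F.fmor_ident[OF that]]
          G.fmor_ident[OF Fx] G.fmor_hom[OF F.fmor_hom[OF i]] G.fmor_hom[OF F.cod.ident_hom[OF Fx]]
          G.cod.ident_hom[OF GFx]])
      then show ?thesis
        using that mor_of_hom[OF i] by (simp add: compF_def)
    qed
    show "leq E (fmor (compF C G F) (cmp C g f))
        (cmp E (fmor (compF C G F) g) (fmor (compF C G F) f))"
      if f: "f \<in> hom C x y" and g: "g \<in> hom C y z" for f g x y z
    proof -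
      note gf = F.dom.cmp_hom[OF f g]
      note Ff = F.fmor_hom[OF f] and Fg = F.fmor_hom[OF g]
      note FgFf = F.cod.cmp_hom[OF Ff Fg]
      have "leq E (fmor G (fmor F (cmp C g f))) (cmp E (fmor G (fmor F g)) (fmor G (fmor F f)))"
        by (rule trans[OF G.fmor_mono[OF F.fmor_hom[OF gf] FgFf F.fmor_cmp[OF f g]]
          G.fmor_cmp[OF Ff Fg] G.fmor_hom[OF F.fmor_hom[OF gf]] G.fmor_hom[OF FgFf]
          G.cod.cmp_hom[OF G.fmor_hom[OF Ff] G.fmor_hom[OF Fg]]])
      then show ?thesis
        using mor_of_hom[OF f] mor_of_hom[OF g] mor_of_hom[OF gf] by (simp add: compF_def)
    qed
  qed
qed

lemma functorder_eqI:
  assumes "functorder C D F" "functorder C D G"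
    and "\<And>x. x \<in> obj C \<Longrightarrow> fobj F x = fobj G x" "\<And>f. f \<in> mor C \<Longrightarrow> fmor F f = fmor G f"
  shows "F = G"
proof -
  interpret F: functorder C D F by fact
  interpret G: functorder C D G by fact
  have "fobj F = fobj G"
    using F.fobj_obj G.fobj_obj assms(3) by (intro extensionalityI[of _ "obj C"]) (auto simp: PiE_def)
  moreover have "fmor F = fmor G"
    using F.fmor_ext G.fmor_ext assms(4) by (intro extensionalityI[of _ "mor C"]) auto
  ultimately show ?thesis by simp
qed

lemma compF_idF_right:
  assumes "functorder C D F"
  shows "compF C F (idF C) = F"
proof -
  interpret functorder C D F by fact
  show ?thesis
    using functorder_compF[OF functorder_idF[OF dom.categorder_axioms] assms] assms
    by (rule functorder_eqI) (simp_all add: compF_def idF_def)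
qed

lemma compF_idF_left:
  assumes "functorder C D F"
  shows "compF C (idF D) F = F"
proof -
  interpret functorder C D F by fact
  have "fobj F x \<in> obj D" if "x \<in> obj C" for x
    using that fobj_obj by auto
  moreover have "fmor F f \<in> mor D" if "f \<in> mor C" for f
    using fmor_hom[of f "src C f" "tgt C f"] that by (simp add: hom_def)
  ultimately show ?thesis
    using functorder_compF[OF assms functorder_idF[OF cod.categorder_axioms]] assms
    by (intro functorder_eqI[of C D _ F]) (simp_all add: compF_def idF_def)
qed

lemma compF_assoc:
  assumes "functorder A B F"
  shows "compF A H (compF A G F) = compF A (compF B H G) F"
proof -
  interpret functorder A B F by fact
  have "fmor F f \<in> mor B" if "f \<in> mor A" for f
    using fmor_hom[of f "src A f" "tgt A f"] that by (simp add: hom_def)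
  then show ?thesis
    using fobj_obj by (auto simp: compF_def fun_eq_iff restrict_def)
qed

definition down :: "('o, 'm) categorder \<Rightarrow> 'm set \<Rightarrow> 'm set" where
  "down C A = {f \<in> mor C. \<exists>g\<in>A. leq C f g}"

definition down_closed :: "('o, 'm) categorder \<Rightarrow> 'm set \<Rightarrow> bool" where
  "down_closed C A \<longleftrightarrow> (\<forall>g\<in>A. \<forall>f\<in>mor C. leq C f g \<longrightarrow> f \<in> A)"

definition homs :: "('o, 'm) categorder \<Rightarrow> 'o set \<Rightarrow> 'o set \<Rightarrow> 'm set" where
  "homs C X Y = (\<Union>x\<in>X. \<Union>y\<in>Y. hom C x y)"

text \<open>
  A morphism of the power categorder is a triple \<open>(X, c, Y)\<close> of its source, a set of morphisms and
  its target, so that one set of morphisms gives different morphisms in different hom sets.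
  As \<open>P1\<close> raises types, and HOL provides no type that holds all its iterates, the category of
  small categorders is spread over all type instances of \<open>categorder\<close> and \<open>functorder\<close>.
\<close>

definition P1 :: "('o, 'm) categorder \<Rightarrow> ('o set, 'o set \<times> 'm set \<times> 'o set) categorder" where
  "P1 C = \<lparr>
    obj = Pow (obj C),
    mor = {(X, c, Y). X \<subseteq> obj C \<and> Y \<subseteq> obj C \<and> c \<subseteq> homs C X Y \<and> down_closed C c},
    src = (\<lambda>(X, c, Y). X),
    tgt = (\<lambda>(X, c, Y). Y),
    ident = (\<lambda>X. (X, down C (ident C ` X), X)),
    cmp = (\<lambda>(X', c', Y') (X, c, Y).
      (X, down C {cmp C g f | f g. f \<in> c \<and> g \<in> c' \<and> tgt C f = src C g}, Y')),
    leq = (\<lambda>(X, c, Y) (X', c', Y'). X = X' \<and> Y = Y' \<and> c \<subseteq> c')\<rparr>"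

definition P1_map :: "('o, 'm) categorder \<Rightarrow> ('p, 'n) categorder \<Rightarrow> ('o, 'm, 'p, 'n) functorder \<Rightarrow>
    ('o set, 'o set \<times> 'm set \<times> 'o set, 'p set, 'p set \<times> 'n set \<times> 'p set) functorder" where
  "P1_map C D F = \<lparr>
    fobj = (\<lambda>X\<in>obj (P1 C). fobj F ` X),
    fmor = (\<lambda>(X, c, Y)\<in>mor (P1 C). (fobj F ` X, down D (fmor F ` c), fobj F ` Y))\<rparr>"

definition eta :: "('o, 'm) categorder \<Rightarrow>
    ('o, 'm, 'o set, 'o set \<times> 'm set \<times> 'o set) functorder" where
  "eta C = \<lparr>
    fobj = (\<lambda>x\<in>obj C. {x}),
    fmor = (\<lambda>f\<in>mor C. ({src C f}, down C {f}, {tgt C f}))\<rparr>"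

definition mu :: "('o, 'm) categorder \<Rightarrow>
    ('o set set,
     'o set set \<times> ('o set \<times> 'm set \<times> 'o set) set \<times> 'o set set,
     'o set, 'o set \<times> 'm set \<times> 'o set) functorder" where
  "mu C = \<lparr>
    fobj = (\<lambda>XX\<in>obj (P1 (P1 C)). \<Union>XX),
    fmor = (\<lambda>(XX, cc, YY)\<in>mor (P1 (P1 C)). (\<Union>XX, \<Union>(X, c, Y)\<in>cc. c, \<Union>YY))\<rparr>"

end

theory Submission
  imports Defs
begin

text \<open>
  Two absorption laws carry everything. Closing a set of morphisms downwards before applying a
  monotone operation (composition, or the action of a functorder) changes nothing once the result
  is closed downwards. And since morphisms of the power categorder are ordered by inclusion and
  are themselves down closed, the union over a set of them is not changed by first closing that
  set downwards. After removing the inner down closures, the monad laws are laws of the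
  powerset monad.
\<close>

section \<open>Membership rules, and the power categorder in terms of triples\<close>

lemma mem_hom: "f \<in> hom C x y \<longleftrightarrow> f \<in> mor C \<and> src C f = x \<and> tgt C f = y"
  by (simp add: hom_def)

lemma mem_homs: "f \<in> homs C X Y \<longleftrightarrow> f \<in> mor C \<and> src C f \<in> X \<and> tgt C f \<in> Y"
  by (auto simp: homs_def hom_def)

lemma mem_down: "f \<in> down C A \<longleftrightarrow> f \<in> mor C \<and> (\<exists>g\<in>A. leq C f g)"
  by (simp add: down_def)

lemma down_mono: "A \<subseteq> B \<Longrightarrow> down C A \<subseteq> down C B"
  unfolding subset_iff mem_down by blast

lemma down_UN: "down C (\<Union>i\<in>I. A i) = (\<Union>i\<in>I. down C (A i))"
  by (auto simp: down_def)

lemma obj_P1 [simp]: "obj (P1 C) = Pow (obj C)"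
  by (simp add: P1_def)

lemma mor_P1: "(X, c, Y) \<in> mor (P1 C) \<longleftrightarrow>
    X \<subseteq> obj C \<and> Y \<subseteq> obj C \<and> c \<subseteq> homs C X Y \<and> down_closed C c"
  by (simp add: P1_def)

lemma src_P1 [simp]: "src (P1 C) (X, c, Y) = X"
  by (simp add: P1_def)

lemma tgt_P1 [simp]: "tgt (P1 C) (X, c, Y) = Y"
  by (simp add: P1_def)

lemma ident_P1 [simp]: "ident (P1 C) X = (X, down C (ident C ` X), X)"
  by (simp add: P1_def)

lemma cmp_P1 [simp]: "cmp (P1 C) (X', c', Y') (X, c, Y) =
    (X, down C {cmp C g f | f g. f \<in> c \<and> g \<in> c' \<and> tgt C f = src C g}, Y')"
  by (simp add: P1_def)

lemma leq_P1 [simp]: "leq (P1 C) (X, c, Y) (X', c', Y') \<longleftrightarrow> X = X' \<and> Y = Y' \<and> c \<subseteq> c'"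
  by (simp add: P1_def)

lemma mor_P1_mem:
  assumes "(X, c, Y) \<in> mor (P1 C)" "f \<in> c"
  shows "f \<in> mor C" "src C f \<in> X" "tgt C f \<in> Y"
  using assms by (auto simp: mor_P1 mem_homs)

lemma mor_P1_downD:
  assumes "(X, c, Y) \<in> mor (P1 C)" "f \<in> c" "g \<in> mor C" "leq C g f"
  shows "g \<in> c"
  using assms by (auto simp: mor_P1 down_closed_def)

section \<open>Composable morphisms and down closures in a categorder\<close>

context categorder
begin

text \<open>The axioms are restated with the condition \<open>tgt C f = src C g\<close> in place of
  hom sets, because a morphism of the power categorder contains morphisms from many hom sets at
  once.\<close>

lemma
  assumes "f \<in> mor C" "g \<in> mor C" "tgt C f = src C g"
  shows cmp_mor: "cmp C g f \<in> mor C"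
    and src_cmp: "src C (cmp C g f) = src C f"
    and tgt_cmp: "tgt C (cmp C g f) = tgt C g"
  using cmp_hom[of f "src C f" "tgt C f" g "tgt C g"] assms by (auto simp: mem_hom)

lemma
  assumes "x \<in> obj C"
  shows ident_mor: "ident C x \<in> mor C"
    and src_ident: "src C (ident C x) = x"
    and tgt_ident: "tgt C (ident C x) = x"
  using ident_hom[OF assms] by (auto simp: mem_hom)

lemma
  assumes "f \<in> mor C"
  shows cmp_ident_src: "cmp C f (ident C (src C f)) = f"
    and cmp_ident_tgt: "cmp C (ident C (tgt C f)) f = f"
  using cmp_ident_right[of f] cmp_ident_left[of f] assms by (auto simp: mem_hom)

lemma cmp_assoc_mor:
  assumes "f \<in> mor C" "g \<in> mor C" "h \<in> mor C" "tgt C f = src C g" "tgt C g = src C h"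
  shows "cmp C h (cmp C g f) = cmp C (cmp C h g) f"
  using cmp_assoc[of f "src C f" "tgt C f" g "tgt C g" h "tgt C h"] assms by (simp add: mem_hom)

lemma
  assumes "f \<in> mor C" "g \<in> mor C" "leq C f g"
  shows leq_src: "src C f = src C g" and leq_tgt: "tgt C f = tgt C g"
  using leq_parallel[OF assms] by auto

lemma cmp_mono_mor:
  assumes "f1 \<in> mor C" "f2 \<in> mor C" "g1 \<in> mor C" "g2 \<in> mor C"
    and "leq C f1 f2" "leq C g1 g2" "tgt C f2 = src C g2"
  shows "leq C (cmp C g1 f1) (cmp C g2 f2)"
  using cmp_mono[of f1 "src C f2" "tgt C f2" f2 g1 "tgt C g2" g2] assms
    leq_src[of f1 f2] leq_tgt[of f1 f2] leq_src[of g1 g2] leq_tgt[of g1 g2]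
  by (simp add: mem_hom)

text \<open>This is transitivity of the ordering, which is available only between morphisms of the
  carrier; hence the hypothesis on \<open>A\<close>.\<close>

lemma down_closed_down: "A \<subseteq> mor C \<Longrightarrow> down_closed C (down C A)"
  unfolding down_closed_def by (auto simp: mem_down) (meson leq_trans subsetD)

lemma subset_down: "A \<subseteq> mor C \<Longrightarrow> A \<subseteq> down C A"
  by (meson leq_refl mem_down subsetD subsetI)

lemma down_least: "down_closed C B \<Longrightarrow> A \<subseteq> B \<Longrightarrow> down C A \<subseteq> B"
  unfolding down_closed_def subset_iff mem_down by blast

lemma down_eq: "down_closed C A \<Longrightarrow> A \<subseteq> mor C \<Longrightarrow> down C A = A"
  by (simp add: down_least subset_down subset_antisym)

text \<open>To compare two closures it is enough to find, above each generator of the first, a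
  generator of the second. Most comparisons of closures below are reduced to this elementwise
  check.\<close>

lemma down_subset_down:
  assumes "B \<subseteq> mor C" "A \<subseteq> down C B"
  shows "down C A \<subseteq> down C B"
  using assms by (simp add: down_closed_down down_least)

text \<open>Closing downwards does not leave \<open>homs C X Y\<close>, since comparable morphisms
  have the same source and target.\<close>

lemma down_mor_P1:
  assumes "X \<subseteq> obj C" "Y \<subseteq> obj C" "A \<subseteq> homs C X Y"
  shows "(X, down C A, Y) \<in> mor (P1 C)"
proof -
  have "A \<subseteq> mor C"
    using assms(3) by (auto simp: mem_homs)
  moreover have "down C A \<subseteq> homs C X Y"
    using assms(3) leq_src leq_tgt by (fastforce simp: mem_down mem_homs)
  ultimately show ?thesis
    using assms by (simp add: mor_P1 down_closed_down)
qed

lemma down_mor_P1_eq: "(X, c, Y) \<in> mor (P1 C) \<Longrightarrow> down C c = c"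
  by (rule down_eq) (auto simp: mor_P1 mem_homs)

section \<open>Composition of sets of morphisms and the categorder laws of
  \<open>P1 C\<close>\<close>

lemma ident_P1_mor: "X \<subseteq> obj C \<Longrightarrow> (X, down C (ident C ` X), X) \<in> mor (P1 C)"
  by (rule down_mor_P1) (auto simp: mem_homs ident_mor src_ident tgt_ident)

text \<open>The elementwise composite before it is closed downwards. It is kept apart because the
  associativity and unit laws hold for it exactly, and closures can be added afterwards.\<close>

definition cmps :: "'m set \<Rightarrow> 'm set \<Rightarrow> 'm set" where
  "cmps d c = {cmp C g f | f g. f \<in> c \<and> g \<in> d \<and> tgt C f = src C g}"

lemma cmps_mor: "c \<subseteq> mor C \<Longrightarrow> d \<subseteq> mor C \<Longrightarrow> cmps d c \<subseteq> mor C"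
  by (auto simp: cmps_def cmp_mor subset_iff)

text \<open>If f' lies above f and g' above g, then monotonicity of composition puts the composite
  of f' and g' above that of f and g.\<close>

lemma cmps_down_subset:
  assumes "c \<subseteq> mor C" "d \<subseteq> mor C"
  shows "cmps (down C d) (down C c) \<subseteq> down C (cmps d c)"
proof
  fix h assume "h \<in> cmps (down C d) (down C c)"
  then obtain f g where h: "h = cmp C g f" and fg: "f \<in> down C c" "g \<in> down C d" "tgt C f = src C g"
    by (auto simp: cmps_def)
  then obtain f' g' where *: "f' \<in> c" "leq C f f'" "g' \<in> d" "leq C g g'" "f \<in> mor C" "g \<in> mor C"
    by (auto simp: mem_down)
  with assms have mor: "f' \<in> mor C" "g' \<in> mor C" by auto
  \<comment> \<open>Comparable morphisms are parallel, so composability passes from \<open>f\<close>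
    and \<open>g\<close> to the morphisms above them.\<close>
  have t: "tgt C f' = src C g'"
    using leq_tgt[of f f'] leq_src[of g g'] * mor fg by simp
  have "leq C h (cmp C g' f')"
    unfolding h by (rule cmp_mono_mor) (use * mor t in auto)
  moreover have "cmp C g' f' \<in> cmps d c"
    using * t by (auto simp: cmps_def)
  moreover have "h \<in> mor C"
    unfolding h using * fg by (simp add: cmp_mor)
  ultimately show "h \<in> down C (cmps d c)"
    by (auto simp: mem_down)
qed

lemma cmps_mono: "c \<subseteq> c' \<Longrightarrow> d \<subseteq> d' \<Longrightarrow> cmps d c \<subseteq> cmps d' c'"
  unfolding cmps_def by blast

text \<open>Absorption for composition: one inclusion is \<open>cmps_down_subset\<close>, the other
  holds because sets of morphisms lie in their closures.\<close>

lemma down_cmps_down: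
  assumes "c \<subseteq> mor C" "d \<subseteq> mor C"
  shows "down C (cmps (down C d) (down C c)) = down C (cmps d c)"
  using assms
  by (intro subset_antisym down_subset_down cmps_mor cmps_down_subset down_mono cmps_mono subset_down)

text \<open>Associativity is inherited element by element. The two composability conditions agree
  because a composite keeps the source of its first factor and the target of its second.\<close>

lemma cmps_assoc:
  assumes "b \<subseteq> mor C" "c \<subseteq> mor C" "d \<subseteq> mor C"
  shows "cmps d (cmps c b) = cmps (cmps d c) b"
proof (intro subset_antisym subsetI)
  fix k assume "k \<in> cmps d (cmps c b)"
  then obtain f g h where k: "k = cmp C h (cmp C g f)" "f \<in> b" "g \<in> c" "h \<in> d"
    "tgt C f = src C g" "tgt C (cmp C g f) = src C h"
    by (auto simp: cmps_def)
  with assms have "f \<in> mor C" "g \<in> mor C" "h \<in> mor C" by auto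
  with k have "k = cmp C (cmp C h g) f" "tgt C g = src C h" "src C (cmp C h g) = src C g"
    by (simp_all add: tgt_cmp src_cmp cmp_assoc_mor)
  with k show "k \<in> cmps (cmps d c) b"
    unfolding cmps_def by fastforce
next
  fix k assume "k \<in> cmps (cmps d c) b"
  then obtain f g h where k: "k = cmp C (cmp C h g) f" "f \<in> b" "g \<in> c" "h \<in> d"
    "tgt C f = src C (cmp C h g)" "tgt C g = src C h"
    by (auto simp: cmps_def)
  with assms have "f \<in> mor C" "g \<in> mor C" "h \<in> mor C" by auto
  with k have "k = cmp C h (cmp C g f)" "tgt C f = src C g" "tgt C (cmp C g f) = tgt C g"
    by (simp_all add: tgt_cmp src_cmp cmp_assoc_mor)
  with k show "k \<in> cmps d (cmps c b)"
    unfolding cmps_def by fastforce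
qed

text \<open>Among the identities of objects of \<open>X\<close>, exactly one can be composed with a
  given f in \<open>c\<close>: the one at the source of f, which lies in \<open>X\<close>.\<close>

lemma cmps_ident_right:
  assumes "X \<subseteq> obj C" "c \<subseteq> homs C X Y"
  shows "cmps c (ident C ` X) = c"
proof -
  have "cmp C f (ident C (src C f)) = f \<and> tgt C (ident C (src C f)) = src C f \<and> src C f \<in> X"
    if "f \<in> c" for f
    using that assms by (auto simp: mem_homs cmp_ident_src tgt_ident src_obj)
  moreover have "cmp C f (ident C x) = f"
    if "f \<in> c" "x \<in> X" "tgt C (ident C x) = src C f" for f x
  proof -
    have "x = src C f" using that assms by (simp add: tgt_ident subset_iff)
    moreover have "f \<in> mor C" using that assms by (auto simp: mem_homs)
    ultimately show ?thesis by (simp add: cmp_ident_src)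
  qed
  ultimately show ?thesis
    unfolding cmps_def by (auto simp: image_iff) metis
qed

lemma cmps_ident_left:
  assumes "Y \<subseteq> obj C" "c \<subseteq> homs C X Y"
  shows "cmps (ident C ` Y) c = c"
proof -
  have "cmp C (ident C (tgt C f)) f = f \<and> src C (ident C (tgt C f)) = tgt C f \<and> tgt C f \<in> Y"
    if "f \<in> c" for f
    using that assms by (auto simp: mem_homs cmp_ident_tgt src_ident tgt_obj)
  moreover have "cmp C (ident C y) f = f"
    if "f \<in> c" "y \<in> Y" "tgt C f = src C (ident C y)" for f y
  proof -
    have "y = tgt C f" using that assms by (simp add: src_ident subset_iff)
    moreover have "f \<in> mor C" using that assms by (auto simp: mem_homs)
    ultimately show ?thesis by (simp add: cmp_ident_tgt)
  qed
  ultimately show ?thesis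
    unfolding cmps_def by (auto simp: image_iff) metis
qed

lemma cmp_P1_cmps: "cmp (P1 C) (X', d, Y') (X, c, Y) = (X, down C (cmps d c), Y')"
  by (simp add: cmps_def)

lemma mor_P1_subset: "(X, c, Y) \<in> mor (P1 C) \<Longrightarrow> c \<subseteq> mor C"
  by (auto simp: mor_P1 mem_homs)

lemma cmps_homs: "c \<subseteq> homs C X Y \<Longrightarrow> d \<subseteq> homs C Y Z \<Longrightarrow> cmps d c \<subseteq> homs C X Z"
  by (auto simp: cmps_def mem_homs subset_iff cmp_mor src_cmp tgt_cmp)

lemma cmp_P1_mor:
  assumes "(X, c, Y) \<in> mor (P1 C)" "(Y, d, Z) \<in> mor (P1 C)"
  shows "(X, down C (cmps d c), Z) \<in> mor (P1 C)"
  using assms by (intro down_mor_P1 cmps_homs[of _ _ Y]) (auto simp: mor_P1)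

lemma categorder_P1: "categorder (P1 C)"
proof
  fix f x y assume "f \<in> hom (P1 C) x y"
  then obtain c where f: "f = (x, c, y)" "(x, c, y) \<in> mor (P1 C)"
    by (cases f) (auto simp: mem_hom)
  note c = mor_P1_subset[OF f(2)]
  have i: "ident C ` z \<subseteq> mor C" if "z \<subseteq> obj C" for z
    using that by (auto simp: ident_mor)
  have "down C (cmps c (down C (ident C ` x))) = c"
    using down_cmps_down[OF i c, of x] cmps_ident_right[of x c y] f
      down_mor_P1_eq[OF f(2)] by (simp add: mor_P1)
  then show "cmp (P1 C) f (ident (P1 C) x) = f"
    by (simp add: f cmp_P1_cmps del: cmp_P1)
  have "down C (cmps (down C (ident C ` y)) c) = c"
    using down_cmps_down[OF c i, of y] cmps_ident_left[of y c x] f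
      down_mor_P1_eq[OF f(2)] by (simp add: mor_P1)
  then show "cmp (P1 C) (ident (P1 C) y) f = f"
    by (simp add: f cmp_P1_cmps del: cmp_P1)
next
  fix f g h w x y z
  assume "f \<in> hom (P1 C) w x" "g \<in> hom (P1 C) x y" "h \<in> hom (P1 C) y z"
  then obtain b c d where fgh: "f = (w, b, x)" "g = (x, c, y)" "h = (y, d, z)"
    and m: "(w, b, x) \<in> mor (P1 C)" "(x, c, y) \<in> mor (P1 C)" "(y, d, z) \<in> mor (P1 C)"
    by (cases f; cases g; cases h) (auto simp: mem_hom)
  note s = m[THEN mor_P1_subset]
  \<comment> \<open>Both sides reduce to the closure of a triple composite without inner closures,
    where \<open>cmps_assoc\<close> applies.\<close>
  have "down C (cmps d (down C (cmps c b))) = down C (cmps (down C (cmps d c)) b)"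
    using down_cmps_down[OF cmps_mor[OF s(1,2)] s(3)] down_cmps_down[OF s(1) cmps_mor[OF s(2,3)]]
      cmps_assoc[OF s] m[THEN down_mor_P1_eq] by simp
  then show "cmp (P1 C) h (cmp (P1 C) g f) = cmp (P1 C) (cmp (P1 C) h g) f"
    by (simp add: fgh cmp_P1_cmps del: cmp_P1)
next
  fix f g x y z
  assume "f \<in> hom (P1 C) x y" "g \<in> hom (P1 C) y z"
  then show "cmp (P1 C) g f \<in> hom (P1 C) x z"
    by (cases f; cases g) (auto simp: mem_hom cmp_P1_cmps cmp_P1_mor simp del: cmp_P1)
next
  fix f1 f2 g1 g2 x y z
  assume "f1 \<in> hom (P1 C) x y" "f2 \<in> hom (P1 C) x y" "g1 \<in> hom (P1 C) y z" "g2 \<in> hom (P1 C) y z"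
    "leq (P1 C) f1 f2" "leq (P1 C) g1 g2"
  then show "leq (P1 C) (cmp (P1 C) g1 f1) (cmp (P1 C) g2 f2)"
    by (cases f1; cases f2; cases g1; cases g2)
      (auto simp: mem_hom cmp_P1_cmps simp del: cmp_P1 intro!: down_mono cmps_mono del: subsetI)
next
  fix x assume "x \<in> obj (P1 C)"
  then show "ident (P1 C) x \<in> hom (P1 C) x x"
    by (simp add: mem_hom ident_P1_mor)
\<comment> \<open>What remains is that sources and targets are objects and that inclusion partially
  orders the triples with a common source and target.\<close>
qed (auto simp: mor_P1)

end

text \<open>A criterion without hom sets: each condition concerns single morphisms, comparable pairs
  or composable pairs, which suits codomains whose morphisms are triples.\<close>

lemma functorder_intro_mor:
  assumes "categorder C" "categorder D"
    and obj: "fobj F \<in> extensional (obj C)" "\<And>x. x \<in> obj C \<Longrightarrow> fobj F x \<in> obj D"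
    and ext: "fmor F \<in> extensional (mor C)"
    and mor: "\<And>f. f \<in> mor C \<Longrightarrow> fmor F f \<in> mor D"
    and src: "\<And>f. f \<in> mor C \<Longrightarrow> src D (fmor F f) = fobj F (src C f)"
    and tgt: "\<And>f. f \<in> mor C \<Longrightarrow> tgt D (fmor F f) = fobj F (tgt C f)"
    and mono: "\<And>f g. f \<in> mor C \<Longrightarrow> g \<in> mor C \<Longrightarrow> leq C f g \<Longrightarrow> leq D (fmor F f) (fmor F g)"
    and ident: "\<And>x. x \<in> obj C \<Longrightarrow> leq D (fmor F (ident C x)) (ident D (fobj F x))"
    and cmp: "\<And>f g. f \<in> mor C \<Longrightarrow> g \<in> mor C \<Longrightarrow> tgt C f = src C g \<Longrightarrow>
      leq D (fmor F (cmp C g f)) (cmp D (fmor F g) (fmor F f))"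
  shows "functorder C D F"
proof -
  interpret C: categorder C by fact
  interpret D: categorder D by fact
  show ?thesis
    by unfold_locales (auto simp: mem_hom PiE_def obj ext mor src tgt mono ident cmp)
qed

section \<open>The functorder that a functorder induces between power categorders\<close>

context functorder
begin

lemma
  assumes "f \<in> mor C"
  shows fmor_mor: "fmor F f \<in> mor D"
    and src_fmor: "src D (fmor F f) = fobj F (src C f)"
    and tgt_fmor: "tgt D (fmor F f) = fobj F (tgt C f)"
  using fmor_hom[of f "src C f" "tgt C f"] assms by (auto simp: mem_hom)

lemma fobj_mem: "x \<in> obj C \<Longrightarrow> fobj F x \<in> obj D"
  using fobj_obj by auto

lemma fmor_mono_mor:
  assumes "f \<in> mor C" "g \<in> mor C" "leq C f g"
  shows "leq D (fmor F f) (fmor F g)"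
  using fmor_mono[of f "src C g" "tgt C g" g] assms dom.leq_src[OF assms] dom.leq_tgt[OF assms]
  by (simp add: mem_hom)

lemma fmor_cmp_mor:
  assumes "f \<in> mor C" "g \<in> mor C" "tgt C f = src C g"
  shows "leq D (fmor F (cmp C g f)) (cmp D (fmor F g) (fmor F f))"
  using fmor_cmp[of f "src C f" "tgt C f" g "tgt C g"] assms by (simp add: mem_hom)

lemma fmor_image_mor: "A \<subseteq> mor C \<Longrightarrow> fmor F ` A \<subseteq> mor D"
  by (auto simp: fmor_mor)

lemma fmor_image_down_subset:
  assumes "A \<subseteq> mor C"
  shows "fmor F ` down C A \<subseteq> down D (fmor F ` A)"
  using assms by (fastforce simp: mem_down fmor_mor intro: fmor_mono_mor)

text \<open>Absorption for the action of a functorder: by monotonicity, the image of anything below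
  \<open>A\<close> lies below the image of \<open>A\<close>.\<close>

lemma down_fmor_image_down:
  assumes "A \<subseteq> mor C"
  shows "down D (fmor F ` down C A) = down D (fmor F ` A)"
  using assms
  by (intro subset_antisym cod.down_subset_down fmor_image_mor fmor_image_down_subset
      down_mono image_mono dom.subset_down)

lemma P1_map_mor:
  assumes "(X, c, Y) \<in> mor (P1 C)"
  shows "(fobj F ` X, down D (fmor F ` c), fobj F ` Y) \<in> mor (P1 D)"
  using assms
  by (intro cod.down_mor_P1)
    (auto simp: mor_P1 mem_homs subset_iff fmor_mor src_fmor tgt_fmor fobj_mem)

lemma functorder_P1_map: "functorder (P1 C) (P1 D) (P1_map C D F)"
proof (rule functorder_intro_mor[OF dom.categorder_P1 cod.categorder_P1])
  fix X assume "X \<in> obj (P1 C)"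
  then have X: "X \<subseteq> obj C" by simp
  have "down D (fmor F ` down C (ident C ` X)) = down D (fmor F ` ident C ` X)"
    using X by (intro down_fmor_image_down) (auto simp: dom.ident_mor)
  \<comment> \<open>Only an inclusion is claimed, because \<open>F\<close> sends an identity to
    something below an identity.\<close>
  also have "\<dots> \<subseteq> down D (ident D ` fobj F ` X)"
  proof (intro cod.down_subset_down)
    show "fmor F ` ident C ` X \<subseteq> down D (ident D ` fobj F ` X)"
      using X fmor_ident by (fastforce simp: mem_down fmor_mor dom.ident_mor)
  qed (use X in \<open>auto simp: cod.ident_mor fobj_mem\<close>)
  finally show "leq (P1 D) (fmor (P1_map C D F) (ident (P1 C) X))
      (ident (P1 D) (fobj (P1_map C D F) X))"
    using X by (simp add: P1_map_def dom.ident_P1_mor)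
next
  fix p q assume pq: "p \<in> mor (P1 C)" "q \<in> mor (P1 C)" "tgt (P1 C) p = src (P1 C) q"
  then obtain X c Y d Z where p: "p = (X, c, Y)" and q: "q = (Y, d, Z)"
    by (cases p; cases q) auto
  have m: "(X, c, Y) \<in> mor (P1 C)" "(Y, d, Z) \<in> mor (P1 C)"
    using pq p q by auto
  note s = m[THEN dom.mor_P1_subset]
  have "down D (fmor F ` down C (dom.cmps d c)) = down D (fmor F ` dom.cmps d c)"
    by (intro down_fmor_image_down dom.cmps_mor s)
  also have "\<dots> \<subseteq> down D (cod.cmps (fmor F ` d) (fmor F ` c))"
  proof (intro cod.down_subset_down cod.cmps_mor fmor_image_mor s subsetI)
    fix h assume "h \<in> fmor F ` dom.cmps d c"
    then obtain f g where fg: "h = fmor F (cmp C g f)" "f \<in> c" "g \<in> d" "tgt C f = src C g"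
      by (auto simp: dom.cmps_def)
    with s have m: "f \<in> mor C" "g \<in> mor C" by auto
    \<comment> \<open>This composite is the witness above \<open>h\<close>: it exists because
      \<open>F\<close> respects sources and targets, and it lies above \<open>h\<close> by laxness
      of \<open>F\<close>.\<close>
    have "cmp D (fmor F g) (fmor F f) \<in> cod.cmps (fmor F ` d) (fmor F ` c)"
      using fg m unfolding cod.cmps_def by (force simp: src_fmor tgt_fmor)
    then show "h \<in> down D (cod.cmps (fmor F ` d) (fmor F ` c))"
      using fg m fmor_cmp_mor[of f g] by (auto simp: mem_down fmor_mor dom.cmp_mor)
  qed
  \<comment> \<open>The inner closures are put back, since composition in \<open>P1 D\<close> is
    applied to images that are already closed.\<close>
  also have "\<dots> = down D (cod.cmps (down D (fmor F ` d)) (down D (fmor F ` c)))"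
    by (intro cod.down_cmps_down[symmetric] fmor_image_mor s)
  finally show "leq (P1 D) (fmor (P1_map C D F) (cmp (P1 C) q p))
      (cmp (P1 D) (fmor (P1_map C D F) q) (fmor (P1_map C D F) p))"
    using m dom.cmp_P1_mor[OF m]
    by (simp add: p q P1_map_def dom.cmp_P1_cmps cod.cmp_P1_cmps del: cmp_P1)
next
  fix p q assume "p \<in> mor (P1 C)" "q \<in> mor (P1 C)" "leq (P1 C) p q"
  then show "leq (P1 D) (fmor (P1_map C D F) p) (fmor (P1_map C D F) q)"
    by (cases p; cases q) (auto simp: P1_map_def intro!: down_mono image_mono del: subsetI)
next
  fix X assume "X \<in> obj (P1 C)"
  then show "fobj (P1_map C D F) X \<in> obj (P1 D)"
    by (auto simp: P1_map_def fobj_mem)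
next
  fix p assume "p \<in> mor (P1 C)"
  moreover obtain X c Y where "p = (X, c, Y)" by (cases p)
  ultimately have p: "p = (X, c, Y)" "(X, c, Y) \<in> mor (P1 C)" by auto
  show "fmor (P1_map C D F) p \<in> mor (P1 D)"
    using p by (simp add: P1_map_def P1_map_mor)
  show "src (P1 D) (fmor (P1_map C D F) p) = fobj (P1_map C D F) (src (P1 C) p)"
    "tgt (P1 D) (fmor (P1_map C D F) p) = fobj (P1_map C D F) (tgt (P1 C) p)"
    using p by (simp_all add: P1_map_def mor_P1)
qed (simp_all add: P1_map_def)

end

text \<open>The functorders are restricted to carriers, so they can be evaluated only at members.
  This is why membership facts such as \<open>P1_map_mor\<close>, \<open>eta_mor\<close> and
  \<open>mu_mor\<close> accompany the computations below.\<close>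

lemma P1_map_apply:
  "X \<subseteq> obj C \<Longrightarrow> fobj (P1_map C D F) X = fobj F ` X"
  "(X, c, Y) \<in> mor (P1 C) \<Longrightarrow>
    fmor (P1_map C D F) (X, c, Y) = (fobj F ` X, down D (fmor F ` c), fobj F ` Y)"
  by (simp_all add: P1_map_def)

lemma eta_apply:
  "x \<in> obj C \<Longrightarrow> fobj (eta C) x = {x}"
  "f \<in> mor C \<Longrightarrow> fmor (eta C) f = ({src C f}, down C {f}, {tgt C f})"
  by (simp_all add: eta_def)

lemma mu_apply:
  "XX \<subseteq> Pow (obj C) \<Longrightarrow> fobj (mu C) XX = \<Union>XX"
  "(XX, cc, YY) \<in> mor (P1 (P1 C)) \<Longrightarrow>
    fmor (mu C) (XX, cc, YY) = (\<Union>XX, \<Union>(X, c, Y)\<in>cc. c, \<Union>YY)"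
  by (simp_all add: mu_def)

lemma idF_apply:
  "x \<in> obj C \<Longrightarrow> fobj (idF C) x = x"
  "f \<in> mor C \<Longrightarrow> fmor (idF C) f = f"
  by (simp_all add: idF_def)

lemma compF_apply:
  "x \<in> obj C \<Longrightarrow> fobj (compF C G F) x = fobj G (fobj F x)"
  "f \<in> mor C \<Longrightarrow> fmor (compF C G F) f = fmor G (fmor F f)"
  by (simp_all add: compF_def)

section \<open>Functoriality of the power construction\<close>

lemma P1_map_idF:
  assumes "categorder C"
  shows "P1_map C C (idF C) = idF (P1 C)"
proof -
  interpret categorder C by fact
  show ?thesis
  proof (rule functorder_eqI[of "P1 C" "P1 C"])
    fix p assume "p \<in> mor (P1 C)"
    moreover obtain X c Y where "p = (X, c, Y)" by (cases p)
    ultimately have p: "p = (X, c, Y)" and m: "(X, c, Y) \<in> mor (P1 C)" by auto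
    have "fmor (idF C) ` c = c"
      using m by (force simp: idF_apply mor_P1_mem)
    moreover have "fobj (idF C) ` X = X" "fobj (idF C) ` Y = Y"
      using m by (auto simp: mor_P1 idF_def)
    ultimately show "fmor (P1_map C C (idF C)) p = fmor (idF (P1 C)) p"
      using m by (simp add: p P1_map_apply idF_apply(2)[of _ "P1 C"] down_mor_P1_eq)
  next
    fix X assume "X \<in> obj (P1 C)"
    then show "fobj (P1_map C C (idF C)) X = fobj (idF (P1 C)) X"
      by (auto simp: P1_map_def idF_def)
  qed (intro functorder.functorder_P1_map functorder_idF categorder_P1 assms)+
qed

text \<open>Applying the two functorders in turn closes downwards twice. The intermediate closure is
  absorbed, so composition is preserved strictly although functorders are lax.\<close>

lemma P1_map_compF:
  assumes "functorder C D F" "functorder D E G"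
  shows "P1_map C E (compF C G F) = compF (P1 C) (P1_map D E G) (P1_map C D F)"
proof -
  interpret F: functorder C D F by fact
  interpret G: functorder D E G by fact
  show ?thesis
  proof (rule functorder_eqI[of "P1 C" "P1 E"])
    show "functorder (P1 C) (P1 E) (P1_map C E (compF C G F))"
      by (intro functorder.functorder_P1_map functorder_compF[OF assms])
    show "functorder (P1 C) (P1 E) (compF (P1 C) (P1_map D E G) (P1_map C D F))"
      by (rule functorder_compF[OF F.functorder_P1_map G.functorder_P1_map])
  next
    fix X assume "X \<in> obj (P1 C)"
    then have "X \<subseteq> obj C" "fobj F ` X \<subseteq> obj D" by (auto simp: F.fobj_mem)
    then show "fobj (P1_map C E (compF C G F)) X =
        fobj (compF (P1 C) (P1_map D E G) (P1_map C D F)) X"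
      by (auto simp: P1_map_apply compF_apply image_image subset_iff intro!: image_cong)
  next
    fix p assume "p \<in> mor (P1 C)"
    moreover obtain X c Y where "p = (X, c, Y)" by (cases p)
    ultimately have p: "p = (X, c, Y)" and m: "(X, c, Y) \<in> mor (P1 C)" by auto
    note s = F.dom.mor_P1_subset[OF m]
    have "fmor (compF C G F) ` c = fmor G ` fmor F ` c"
      using s by (force simp: compF_apply)
    moreover have "fobj (compF C G F) ` X = fobj G ` fobj F ` X"
      "fobj (compF C G F) ` Y = fobj G ` fobj F ` Y"
      using m by (auto simp: mor_P1 compF_apply image_image subset_iff intro!: image_cong)
    moreover have "down E (fmor G ` down D (fmor F ` c)) = down E (fmor G ` fmor F ` c)"
      by (intro G.down_fmor_image_down F.fmor_image_mor s)
    ultimately show "fmor (P1_map C E (compF C G F)) p =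
        fmor (compF (P1 C) (P1_map D E G) (P1_map C D F)) p"
      using m F.P1_map_mor[OF m] by (simp add: p P1_map_apply compF_apply(2)[of _ "P1 C"])
  qed
qed

section \<open>The unit and its naturality\<close>

lemma (in categorder) eta_mor: "f \<in> mor C \<Longrightarrow> ({src C f}, down C {f}, {tgt C f}) \<in> mor (P1 C)"
  by (rule down_mor_P1) (simp_all add: mem_homs src_obj tgt_obj)

lemma functorder_eta:
  assumes "categorder C"
  shows "functorder C (P1 C) (eta C)"
proof -
  interpret categorder C by fact
  show ?thesis
  proof (rule functorder_intro_mor[OF assms categorder_P1])
    fix f g assume f: "f \<in> mor C" and g: "g \<in> mor C" and fg: "tgt C f = src C g"
    \<comment> \<open>Viewing the composite as \<open>cmps\<close> of two singletons makes
      absorption applicable; it yields an equality, more than the inequality required.\<close>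
    have "down C {cmp C g f} = down C (cmps {g} {f})"
      using fg by (simp add: cmps_def)
    also have "\<dots> = down C (cmps (down C {g}) (down C {f}))"
      using f g by (simp add: down_cmps_down)
    finally show "leq (P1 C) (fmor (eta C) (cmp C g f))
        (cmp (P1 C) (fmor (eta C) g) (fmor (eta C) f))"
      using f g fg
      by (simp add: eta_apply cmp_mor src_cmp tgt_cmp cmp_P1_cmps del: cmp_P1)
  next
    fix f g assume "f \<in> mor C" "g \<in> mor C" "leq C f g"
    then show "leq (P1 C) (fmor (eta C) f) (fmor (eta C) g)"
      using leq_src[of f g] leq_tgt[of f g] down_subset_down[of "{g}" "{f}"]
      by (simp add: eta_apply mem_down)
  qed (auto simp: eta_apply eta_mor ident_mor src_ident tgt_ident src_obj tgt_obj,
      simp_all add: eta_def)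
qed

lemma eta_natural:
  assumes "functorder C D F"
  shows "compF C (P1_map C D F) (eta C) = compF C (eta D) F"
proof -
  interpret functorder C D F by fact
  show ?thesis
  proof (rule functorder_eqI[of C "P1 D"])
    show "functorder C (P1 D) (compF C (P1_map C D F) (eta C))"
      by (rule functorder_compF[OF functorder_eta[OF dom.categorder_axioms] functorder_P1_map])
    show "functorder C (P1 D) (compF C (eta D) F)"
      by (rule functorder_compF[OF assms functorder_eta[OF cod.categorder_axioms]])
  \<comment> \<open>On a morphism f the left side closes the image of \<open>down C {f}\<close>;
    absorption for a singleton turns this into the closure of \<open>{fmor F f}\<close>.\<close>
  qed (use down_fmor_image_down in \<open>simp_all add: compF_apply eta_apply P1_map_apply dom.eta_mor
      fobj_mem fmor_mor src_fmor tgt_fmor\<close>)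
qed

section \<open>The multiplication and its naturality\<close>

lemma mem_mu: "f \<in> (\<Union>(X, c, Y)\<in>cc. c) \<longleftrightarrow> (\<exists>X c Y. (X, c, Y) \<in> cc \<and> f \<in> c)"
  by force

text \<open>A union of down closed sets is down closed, so \<open>mu\<close> needs no closure of its
  own.\<close>

lemma mu_mor:
  assumes "(XX, cc, YY) \<in> mor (P1 (P1 C))"
  shows "(\<Union>XX, \<Union>(X, c, Y)\<in>cc. c, \<Union>YY) \<in> mor (P1 C)"
proof -
  have "(X, c, Y) \<in> mor (P1 C) \<and> X \<in> XX \<and> Y \<in> YY" if "(X, c, Y) \<in> cc" for X c Y
    using mor_P1_mem[OF assms that] by simp
  then have "f \<in> homs C (\<Union>XX) (\<Union>YY)" "\<And>g. g \<in> mor C \<Longrightarrow> leq C g f \<Longrightarrow> g \<in> c"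
    if "(X, c, Y) \<in> cc" "f \<in> c" for X c Y f
    using that mor_P1_mem[of X c Y C f] mor_P1_downD[of X c Y C f] by (auto simp: mem_homs)
  then have "(\<Union>(X, c, Y)\<in>cc. c) \<subseteq> homs C (\<Union>XX) (\<Union>YY)"
    "down_closed C (\<Union>(X, c, Y)\<in>cc. c)"
    unfolding down_closed_def subset_iff Ball_def mem_mu by blast+
  then show ?thesis
    using assms by (auto simp: mor_P1)
qed

text \<open>Absorption for unions: a morphism below a member of \<open>A\<close> carries a smaller
  set and so adds nothing to the union, while every member of \<open>A\<close> lies below
  itself.\<close>

lemma Union_down_P1:
  assumes "A \<subseteq> mor (P1 C)"
  shows "(\<Union>(X, c, Y)\<in>down (P1 C) A. c) = (\<Union>(X, c, Y)\<in>A. c)"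
proof (intro subset_antisym subsetI)
  fix f assume "f \<in> (\<Union>(X, c, Y)\<in>down (P1 C) A. c)"
  then obtain X c Y X' c' Y' where "f \<in> c" "(X', c', Y') \<in> A" "leq (P1 C) (X, c, Y) (X', c', Y')"
    unfolding mem_mu mem_down by (metis prod_cases3)
  then show "f \<in> (\<Union>(X, c, Y)\<in>A. c)"
    unfolding mem_mu leq_P1 by blast
next
  fix f assume "f \<in> (\<Union>(X, c, Y)\<in>A. c)"
  then obtain X c Y where "f \<in> c" "(X, c, Y) \<in> A"
    by auto
  moreover from this have "(X, c, Y) \<in> down (P1 C) A"
    using assms by (force simp: mem_down)
  ultimately show "f \<in> (\<Union>(X, c, Y)\<in>down (P1 C) A. c)"
    by force
qed

lemma functorder_mu:
  assumes "categorder C"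
  shows "functorder (P1 (P1 C)) (P1 C) (mu C)"
proof -
  interpret categorder C by fact
  interpret P: categorder "P1 C" by (rule categorder_P1)
  show ?thesis
  proof (rule functorder_intro_mor[OF P.categorder_P1 P.categorder_axioms])
    fix XX assume "XX \<in> obj (P1 (P1 C))"
    then have XX: "XX \<subseteq> Pow (obj C)" by simp
    have "(\<Union>(X, c, Y)\<in>down (P1 C) (ident (P1 C) ` XX). c) =
        (\<Union>(X, c, Y)\<in>ident (P1 C) ` XX. c)"
      using XX by (intro Union_down_P1 image_subsetI P.ident_mor) auto
    also have "\<dots> \<subseteq> down C (ident C ` \<Union>XX)"
      by (simp add: UN_least Union_upper down_mono image_mono)
    finally show "leq (P1 C) (fmor (mu C) (ident (P1 (P1 C)) XX)) (ident (P1 C) (fobj (mu C) XX))"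
      using XX P.ident_P1_mor[of XX] by (simp add: mu_apply)
  next
    fix p q
    assume pq: "p \<in> mor (P1 (P1 C))" "q \<in> mor (P1 (P1 C))" "tgt (P1 (P1 C)) p = src (P1 (P1 C)) q"
    then obtain XX cc YY dd ZZ where p: "p = (XX, cc, YY)" and q: "q = (YY, dd, ZZ)"
      by (cases p; cases q) auto
    have m: "(XX, cc, YY) \<in> mor (P1 (P1 C))" "(YY, dd, ZZ) \<in> mor (P1 (P1 C))"
      using pq p q by auto
    have "(\<Union>(X, c, Y)\<in>down (P1 C) (P.cmps dd cc). c) = (\<Union>(X, c, Y)\<in>P.cmps dd cc. c)"
      by (intro Union_down_P1 P.cmps_mor m[THEN P.mor_P1_subset])
    \<comment> \<open>The inclusion can be proper: on the right, members of \<open>c\<close> and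
      \<open>d\<close> are composed whenever they fit, even if the target of the triple of
      \<open>c\<close> differs from the source of the triple of \<open>d\<close>.\<close>
    also have "\<dots> \<subseteq> down C (cmps (\<Union>(X, c, Y)\<in>dd. c) (\<Union>(X, c, Y)\<in>cc. c))"
    proof
      fix h assume "h \<in> (\<Union>(X, c, Y)\<in>P.cmps dd cc. c)"
      then obtain X c Y d Z where cd: "(X, c, Y) \<in> cc" "(Y, d, Z) \<in> dd" and h: "h \<in> down C (cmps d c)"
        by (auto simp: P.cmps_def cmps_def)
      have "cmps d c \<subseteq> cmps (\<Union>(X, c, Y)\<in>dd. c) (\<Union>(X, c, Y)\<in>cc. c)"
        using cd by (intro cmps_mono) force+
      then show "h \<in> down C (cmps (\<Union>(X, c, Y)\<in>dd. c) (\<Union>(X, c, Y)\<in>cc. c))"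
        using h down_mono by blast
    qed
    finally show "leq (P1 C) (fmor (mu C) (cmp (P1 (P1 C)) q p))
        (cmp (P1 C) (fmor (mu C) q) (fmor (mu C) p))"
      using m P.cmp_P1_mor[OF m]
      by (simp add: p q mu_apply P.cmp_P1_cmps cmp_P1_cmps del: cmp_P1)
  next
    fix p q assume "p \<in> mor (P1 (P1 C))" "q \<in> mor (P1 (P1 C))" "leq (P1 (P1 C)) p q"
    then show "leq (P1 C) (fmor (mu C) p) (fmor (mu C) q)"
      by (cases p; cases q) (auto simp: mu_apply)
  next
    fix p assume "p \<in> mor (P1 (P1 C))"
    moreover obtain XX cc YY where "p = (XX, cc, YY)" by (cases p)
    ultimately have p: "p = (XX, cc, YY)" and m: "(XX, cc, YY) \<in> mor (P1 (P1 C))" by auto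
    then have "XX \<subseteq> Pow (obj C)" "YY \<subseteq> Pow (obj C)" by (simp_all add: mor_P1)
    with m show "fmor (mu C) p \<in> mor (P1 C)"
      "src (P1 C) (fmor (mu C) p) = fobj (mu C) (src (P1 (P1 C)) p)"
      "tgt (P1 C) (fmor (mu C) p) = fobj (mu C) (tgt (P1 (P1 C)) p)"
      by (simp_all add: p mu_apply mu_mor)
  qed (auto simp: mu_def)
qed

text \<open>The closure in \<open>P1 D\<close> disappears under the union by
  \<open>Union_down_P1\<close>; then it remains to use that images and down closures commute with
  unions.\<close>

lemma mu_natural:
  assumes "functorder C D F"
  shows "compF (P1 (P1 C)) (P1_map C D F) (mu C) =
    compF (P1 (P1 C)) (mu D) (P1_map (P1 C) (P1 D) (P1_map C D F))"
proof -
  interpret functorder C D F by fact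
  interpret P: functorder "P1 C" "P1 D" "P1_map C D F" by (rule functorder_P1_map)
  show ?thesis
  proof (rule functorder_eqI[of "P1 (P1 C)" "P1 D"])
    show "functorder (P1 (P1 C)) (P1 D) (compF (P1 (P1 C)) (P1_map C D F) (mu C))"
      by (rule functorder_compF[OF functorder_mu[OF dom.categorder_axioms] functorder_P1_map])
    show "functorder (P1 (P1 C)) (P1 D)
        (compF (P1 (P1 C)) (mu D) (P1_map (P1 C) (P1 D) (P1_map C D F)))"
      by (rule functorder_compF[OF P.functorder_P1_map functorder_mu[OF cod.categorder_axioms]])
    have obj: "fobj (P1_map C D F) ` XX \<subseteq> Pow (obj D)"
      "\<Union>(fobj (P1_map C D F) ` XX) = fobj F ` \<Union>XX" if "XX \<subseteq> Pow (obj C)" for XX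
      using that P.fobj_mem by (auto simp: P1_map_apply subset_iff)
    show "fobj (compF (P1 (P1 C)) (P1_map C D F) (mu C)) XX =
        fobj (compF (P1 (P1 C)) (mu D) (P1_map (P1 C) (P1 D) (P1_map C D F))) XX"
      if "XX \<in> obj (P1 (P1 C))" for XX
    proof -
      have "XX \<subseteq> Pow (obj C)" "\<Union>XX \<subseteq> obj C" using that by auto
      then show ?thesis
        using obj[of XX] that
        by (simp add: compF_apply mu_apply P1_map_apply(1)[of _ "P1 C"] P1_map_apply(1)[of "\<Union>XX"])
    qed
    fix p assume "p \<in> mor (P1 (P1 C))"
    moreover obtain XX cc YY where "p = (XX, cc, YY)" by (cases p)
    ultimately have p: "p = (XX, cc, YY)" and m: "(XX, cc, YY) \<in> mor (P1 (P1 C))" by auto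
    note s = P.dom.mor_P1_subset[OF m]
    have XY: "XX \<subseteq> Pow (obj C)" "YY \<subseteq> Pow (obj C)" using m by (simp_all add: mor_P1)
    have apply_F: "fmor (P1_map C D F) (X, c, Y) = (fobj F ` X, down D (fmor F ` c), fobj F ` Y)"
      if "(X, c, Y) \<in> cc" for X c Y
      using that s by (intro P1_map_apply) auto
    have "(\<Union>(X, c, Y)\<in>down (P1 D) (fmor (P1_map C D F) ` cc). c) =
        (\<Union>(X, c, Y)\<in>fmor (P1_map C D F) ` cc. c)"
      by (intro Union_down_P1 P.fmor_image_mor s)
    also have "\<dots> = (\<Union>(X, c, Y)\<in>cc. down D (fmor F ` c))"
      unfolding image_image by (intro SUP_cong refl) (auto simp: apply_F)
    also have "\<dots> = down D (fmor F ` (\<Union>(X, c, Y)\<in>cc. c))"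
      by (simp add: image_UN down_UN split_beta)
    finally show "fmor (compF (P1 (P1 C)) (P1_map C D F) (mu C)) p =
        fmor (compF (P1 (P1 C)) (mu D) (P1_map (P1 C) (P1 D) (P1_map C D F))) p"
      using m mu_mor[OF m] P.P1_map_mor[OF m] obj[OF XY(1)] obj[OF XY(2)]
      by (simp add: p compF_apply(2)[of _ "P1 (P1 C)"] mu_apply P1_map_apply(2))
  qed
qed

section \<open>The monad laws\<close>

lemma mu_eta_P1:
  assumes "categorder C"
  shows "compF (P1 C) (mu C) (eta (P1 C)) = idF (P1 C)"
proof -
  interpret categorder C by fact
  interpret P: categorder "P1 C" by (rule categorder_P1)
  show ?thesis
  proof (rule functorder_eqI[of "P1 C" "P1 C"])
    show "functorder (P1 C) (P1 C) (compF (P1 C) (mu C) (eta (P1 C)))"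
      by (rule functorder_compF[OF functorder_eta[OF categorder_P1] functorder_mu[OF assms]])
    show "functorder (P1 C) (P1 C) (idF (P1 C))"
      by (rule functorder_idF[OF categorder_P1])
    show "fobj (compF (P1 C) (mu C) (eta (P1 C))) X = fobj (idF (P1 C)) X"
      if "X \<in> obj (P1 C)" for X
      using that by (simp add: compF_apply eta_apply mu_apply idF_apply)
    fix p assume "p \<in> mor (P1 C)"
    moreover obtain X c Y where "p = (X, c, Y)" by (cases p)
    ultimately have p: "p = (X, c, Y)" and m: "(X, c, Y) \<in> mor (P1 C)" by auto
    show "fmor (compF (P1 C) (mu C) (eta (P1 C))) p = fmor (idF (P1 C)) p"
      \<comment> \<open>The unit sends \<open>p\<close> to the closure of \<open>{p}\<close>, and
        the union over this closure is the union over \<open>{p}\<close>, which is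
        \<open>c\<close>.\<close>
      using m P.eta_mor[OF m] Union_down_P1[of "{p}" C]
      by (simp add: p compF_apply eta_apply mu_apply idF_apply)
  qed
qed

lemma mu_P1_eta:
  assumes "categorder C"
  shows "compF (P1 C) (mu C) (P1_map C (P1 C) (eta C)) = idF (P1 C)"
proof -
  interpret categorder C by fact
  interpret eta: functorder C "P1 C" "eta C" by (rule functorder_eta[OF assms])
  show ?thesis
  proof (rule functorder_eqI[of "P1 C" "P1 C"])
    show "functorder (P1 C) (P1 C) (compF (P1 C) (mu C) (P1_map C (P1 C) (eta C)))"
      by (rule functorder_compF[OF eta.functorder_P1_map functorder_mu[OF assms]])
    show "functorder (P1 C) (P1 C) (idF (P1 C))"
      by (rule functorder_idF[OF categorder_P1])
    have obj: "fobj (eta C) ` X \<subseteq> Pow (obj C)" "\<Union>(fobj (eta C) ` X) = X" if "X \<subseteq> obj C" for X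
      using that by (auto simp: eta_apply subset_iff)
    show "fobj (compF (P1 C) (mu C) (P1_map C (P1 C) (eta C))) X = fobj (idF (P1 C)) X"
      if "X \<in> obj (P1 C)" for X
      using that obj[of X] by (simp add: compF_apply P1_map_apply mu_apply idF_apply)
    fix p assume "p \<in> mor (P1 C)"
    moreover obtain X c Y where "p = (X, c, Y)" by (cases p)
    ultimately have p: "p = (X, c, Y)" and m: "(X, c, Y) \<in> mor (P1 C)" by auto
    have XY: "X \<subseteq> obj C" "Y \<subseteq> obj C" using m by (simp_all add: mor_P1)
    note s = mor_P1_subset[OF m]
    have "(\<Union>(X, c, Y)\<in>down (P1 C) (fmor (eta C) ` c). c) = (\<Union>(X, c, Y)\<in>fmor (eta C) ` c. c)"
      by (intro Union_down_P1 eta.fmor_image_mor s)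
    also have "\<dots> = (\<Union>f\<in>c. down C {f})"
      using s unfolding image_image by (intro SUP_cong refl) (auto simp: eta_apply)
    \<comment> \<open>A closure is the union of the closures of its single elements; since
      \<open>c\<close> is down closed, the result is \<open>c\<close> again.\<close>
    also have "\<dots> = down C c"
      by (auto simp: mem_down)
    finally show "fmor (compF (P1 C) (mu C) (P1_map C (P1 C) (eta C))) p = fmor (idF (P1 C)) p"
      using m eta.P1_map_mor[OF m] obj[OF XY(1)] obj[OF XY(2)] down_mor_P1_eq[OF m]
      by (simp add: p compF_apply P1_map_apply mu_apply idF_apply)
  qed
qed

text \<open>Once the closure introduced by \<open>P1_map\<close> is absorbed, both composites are
  the same double union, taken in two orders.\<close>

lemma mu_assoc:
  assumes "categorder C"
  shows "compF (P1 (P1 (P1 C))) (mu C) (mu (P1 C)) =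
    compF (P1 (P1 (P1 C))) (mu C) (P1_map (P1 (P1 C)) (P1 C) (mu C))"
proof -
  interpret categorder C by fact
  interpret P: categorder "P1 C" by (rule categorder_P1)
  interpret mu: functorder "P1 (P1 C)" "P1 C" "mu C" by (rule functorder_mu[OF assms])
  show ?thesis
  proof (rule functorder_eqI[of "P1 (P1 (P1 C))" "P1 C"])
    show "functorder (P1 (P1 (P1 C))) (P1 C) (compF (P1 (P1 (P1 C))) (mu C) (mu (P1 C)))"
      by (rule functorder_compF[OF functorder_mu[OF categorder_P1] functorder_mu[OF assms]])
    show "functorder (P1 (P1 (P1 C))) (P1 C)
        (compF (P1 (P1 (P1 C))) (mu C) (P1_map (P1 (P1 C)) (P1 C) (mu C)))"
      by (rule functorder_compF[OF mu.functorder_P1_map functorder_mu[OF assms]])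
    have obj: "fobj (mu C) ` X \<subseteq> Pow (obj C)" "\<Union>(fobj (mu C) ` X) = \<Union>(\<Union>X)"
      "\<Union>X \<subseteq> Pow (obj C)" if "X \<subseteq> Pow (Pow (obj C))" for X
      using that mu.fobj_mem by (auto simp: mu_apply subset_iff)
    show "fobj (compF (P1 (P1 (P1 C))) (mu C) (mu (P1 C))) X =
        fobj (compF (P1 (P1 (P1 C))) (mu C) (P1_map (P1 (P1 C)) (P1 C) (mu C))) X"
      if "X \<in> obj (P1 (P1 (P1 C)))" for X
      using that obj[of X] by (simp add: compF_apply P1_map_apply mu_apply)
    fix p assume "p \<in> mor (P1 (P1 (P1 C)))"
    moreover obtain X c Y where "p = (X, c, Y)" by (cases p)
    ultimately have p: "p = (X, c, Y)" and m: "(X, c, Y) \<in> mor (P1 (P1 (P1 C)))" by auto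
    have XY: "X \<subseteq> Pow (Pow (obj C))" "Y \<subseteq> Pow (Pow (obj C))" using m by (simp_all add: mor_P1)
    note s = mu.dom.mor_P1_subset[OF m]
    have apply_mu: "fmor (mu C) (XX, cc, YY) = (\<Union>XX, \<Union>(X, c, Y)\<in>cc. c, \<Union>YY)"
      if "(XX, cc, YY) \<in> c" for XX cc YY
      using that s by (intro mu_apply) auto
    have "(\<Union>(X, c, Y)\<in>down (P1 C) (fmor (mu C) ` c). c) = (\<Union>(X, c, Y)\<in>fmor (mu C) ` c. c)"
      by (intro Union_down_P1 mu.fmor_image_mor s)
    also have "\<dots> = (\<Union>(XX, cc, YY)\<in>c. \<Union>(X, c, Y)\<in>cc. c)"
      unfolding image_image by (intro SUP_cong refl) (clarsimp simp: apply_mu)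
    also have "\<dots> = (\<Union>(X, c, Y)\<in>(\<Union>(XX, cc, YY)\<in>c. cc). c)"
      unfolding UN_UN_flatten by (simp add: split_beta)
    finally show "fmor (compF (P1 (P1 (P1 C))) (mu C) (mu (P1 C))) p =
        fmor (compF (P1 (P1 (P1 C))) (mu C) (P1_map (P1 (P1 C)) (P1 C) (mu C))) p"
      using m mu_mor[OF m] mu.P1_map_mor[OF m] obj[OF XY(1)] obj[OF XY(2)]
      by (simp add: p compF_apply P1_map_apply mu_apply)
  qed
qed

theorem theorem5p1:
  shows
    \<comment> \<open>the functor P1: objects, morphisms, identities, composition\<close>
    "(\<forall>C :: ('a, 'b) categorder. categorder C \<longrightarrow> categorder (P1 C)) \<and>
     (\<forall>(C :: ('a, 'b) categorder) (D :: ('c, 'd) categorder) F.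
        functorder C D F \<longrightarrow> functorder (P1 C) (P1 D) (P1_map C D F)) \<and>
     (\<forall>C :: ('a, 'b) categorder. categorder C \<longrightarrow> P1_map C C (idF C) = idF (P1 C)) \<and>
     (\<forall>(C :: ('a, 'b) categorder) (D :: ('c, 'd) categorder) (E :: ('e, 'f) categorder) F G.
        functorder C D F \<longrightarrow> functorder D E G \<longrightarrow>
        P1_map C E (compF C G F) = compF (P1 C) (P1_map D E G) (P1_map C D F)) \<and>
     \<comment> \<open>the natural transformation eta\<close>
     (\<forall>C :: ('a, 'b) categorder. categorder C \<longrightarrow> functorder C (P1 C) (eta C)) \<and>
     (\<forall>(C :: ('a, 'b) categorder) (D :: ('c, 'd) categorder) F. functorder C D F \<longrightarrow>
        compF C (P1_map C D F) (eta C) = compF C (eta D) F) \<and>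
     \<comment> \<open>the natural transformation mu\<close>
     (\<forall>C :: ('a, 'b) categorder. categorder C \<longrightarrow> functorder (P1 (P1 C)) (P1 C) (mu C)) \<and>
     (\<forall>(C :: ('a, 'b) categorder) (D :: ('c, 'd) categorder) F. functorder C D F \<longrightarrow>
        compF (P1 (P1 C)) (P1_map C D F) (mu C) =
        compF (P1 (P1 C)) (mu D) (P1_map (P1 C) (P1 D) (P1_map C D F))) \<and>
     \<comment> \<open>the monad laws: left unit, right unit, associativity\<close>
     (\<forall>C :: ('a, 'b) categorder. categorder C \<longrightarrow>
        compF (P1 C) (mu C) (eta (P1 C)) = idF (P1 C)) \<and>
     (\<forall>C :: ('a, 'b) categorder. categorder C \<longrightarrow>
        compF (P1 C) (mu C) (P1_map C (P1 C) (eta C)) = idF (P1 C)) \<and>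
     (\<forall>C :: ('a, 'b) categorder. categorder C \<longrightarrow>
        compF (P1 (P1 (P1 C))) (mu C) (mu (P1 C)) =
        compF (P1 (P1 (P1 C))) (mu C) (P1_map (P1 (P1 C)) (P1 C) (mu C)))"
  by (intro conjI allI impI categorder.categorder_P1 functorder.functorder_P1_map P1_map_idF
      P1_map_compF functorder_eta eta_natural functorder_mu mu_natural mu_eta_P1 mu_P1_eta mu_assoc)

end
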